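(* Let $\mathcal{Z}$ be a set of positive integers. For every proper subset $\mathcal{Y}\subsetneq\mathcal{Z}$ there exists a triangular sum with cross terms that represents every element of $\mathcal{Y}$ but does not represent every element of $\mathcal{Z}$.
   Context: $T_x=\frac{x(x+1)}{2}$ and $B_{xy}=\frac14(2xy+x+y)$ for integers $x,y$. Let $Q(X)=\sum_{i=1}^k a_iX_i^2+\sum_{1\leq i<j\leq k}4c_{ij}X_iX_j$ be a positive definite quadratic form with integers $a_i,c_{ij}$. The triangular sum with cross terms attached to $Q$ is $f_Q(x)=\sum_{i=1}^k a_iT_{x_i}+\sum_{i<j}4c_{ij}B_{x_ix_j}+C$, where $C$ is the unique integer such that $f_Q$ is normalized totally positive, i.e. $f_Q(\mathbb{Z}^k)$ consists of nonnegative integers and contains $0$. A polynomial $f$ represents $n$ if $f(x)=n$ for some $x\in\mathbb{Z}^k$. *)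

theory Defs
  imports Complex_Main
begin

text \<open>
  A point of \<open>\<int>\<^sup>k\<close> or \<open>\<real>\<^sup>k\<close> is a function on \<open>nat\<close> of which only the values at the
  indices \<open>1..k\<close> are used. Only the coefficients \<open>c i j\<close> with \<open>1 \<le> i < j \<le> k\<close> are used.
\<close>

definition T :: "int \<Rightarrow> real" where
  "T x = of_int (x * (x + 1)) / 2"

definition B :: "int \<Rightarrow> int \<Rightarrow> real" where
  "B x y = 1 / 4 * of_int (2 * x * y + x + y)"

definition quad_form ::
  "nat \<Rightarrow> (nat \<Rightarrow> int) \<Rightarrow> (nat \<Rightarrow> nat \<Rightarrow> int) \<Rightarrow> (nat \<Rightarrow> real) \<Rightarrow> real" where
  "quad_form k a c X =
     (\<Sum>i = 1..k. of_int (a i) * (X i)\<^sup>2)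
     + (\<Sum>i = 1..k. \<Sum>j = i + 1..k. 4 * of_int (c i j) * X i * X j)"

definition pos_def :: "nat \<Rightarrow> (nat \<Rightarrow> int) \<Rightarrow> (nat \<Rightarrow> nat \<Rightarrow> int) \<Rightarrow> bool" where
  "pos_def k a c \<longleftrightarrow>
     (\<forall>X :: nat \<Rightarrow> real. (\<exists>i\<in>{1..k}. X i \<noteq> 0) \<longrightarrow> 0 < quad_form k a c X)"

definition tri_sum ::
  "nat \<Rightarrow> (nat \<Rightarrow> int) \<Rightarrow> (nat \<Rightarrow> nat \<Rightarrow> int) \<Rightarrow> int \<Rightarrow> (nat \<Rightarrow> int) \<Rightarrow> real" where
  "tri_sum k a c C x =
     (\<Sum>i = 1..k. of_int (a i) * T (x i))
     + (\<Sum>i = 1..k. \<Sum>j = i + 1..k. 4 * of_int (c i j) * B (x i) (x j))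
     + of_int C"

definition normalized_totally_positive :: "((nat \<Rightarrow> int) \<Rightarrow> real) \<Rightarrow> bool" where
  "normalized_totally_positive f \<longleftrightarrow> range f \<subseteq> \<nat> \<and> 0 \<in> range f"

definition triangular_sum_with_cross_terms :: "nat \<Rightarrow> ((nat \<Rightarrow> int) \<Rightarrow> real) \<Rightarrow> bool" where
  "triangular_sum_with_cross_terms k f \<longleftrightarrow>
     k \<ge> 1 \<and>
     (\<exists>a c C. pos_def k a c \<and> f = tri_sum k a c C \<and> normalized_totally_positive f)"

definition represents :: "((nat \<Rightarrow> int) \<Rightarrow> real) \<Rightarrow> int \<Rightarrow> bool" where
  "represents f n \<longleftrightarrow> (\<exists>x. f x = of_int n)"

text \<open>
  The additive constant \<open>C\<close> exists and is unique for every positive definite form of this shape, so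
  each such form has exactly one triangular sum with cross terms attached to it.
\<close>

lemma tri_sum_eq_quad_form:
  "8 * (tri_sum k a c 0 x) =
     quad_form k a c (\<lambda>i. of_int (2 * x i + 1)) - quad_form k a c (\<lambda>i. 1)"
proof -
  have T: "8 * (of_int d * T y) = of_int d * (of_int (2 * y + 1))\<^sup>2 - of_int d * 1\<^sup>2" for d y
    by (simp add: T_def power2_eq_square algebra_simps)
  have B: "8 * (4 * of_int d * B y z) =
      4 * of_int d * of_int (2 * y + 1) * of_int (2 * z + 1) - 4 * of_int d * 1 * 1" for d y z
    by (simp add: B_def algebra_simps)
  show ?thesis
    unfolding tri_sum_def quad_form_def distrib_left sum_distrib_left T B sum_subtractf by simp
qed

lemma tri_sum_Ints: "tri_sum k a c C x \<in> \<int>"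
proof -
  have "T y \<in> \<int>" for y
  proof -
    have "even (y * (y + 1))" by simp
    then obtain z where "y * (y + 1) = 2 * z" by blast
    then have "T y = of_int z" unfolding T_def by simp
    then show ?thesis by simp
  qed
  moreover have "4 * of_int d * B y z \<in> \<int>" for d y z
  proof -
    have "4 * of_int d * B y z = of_int (d * (2 * y * z + y + z))"
      unfolding B_def by simp
    then show ?thesis by (metis Ints_of_int)
  qed
  ultimately show ?thesis
    unfolding tri_sum_def by (intro Ints_add Ints_sum) auto
qed

lemma ex1_normalizing_constant:
  assumes "pos_def k a c"
  shows "\<exists>!C. normalized_totally_positive (tri_sum k a c C)"
proof -
  define g where "g x = \<lfloor>tri_sum k a c 0 x\<rfloor>" for x
  have g: "tri_sum k a c C x = of_int (g x + C)" for C x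
  proof -
    have "of_int (g x) = tri_sum k a c 0 x"
      unfolding g_def using tri_sum_Ints by simp
    then show ?thesis by (simp add: tri_sum_def)
  qed
  define L where "L = \<lfloor>- quad_form k a c (\<lambda>i. 1) / 8\<rfloor>"
  have nonneg: "0 \<le> quad_form k a c X" for X
  proof (cases "\<exists>i\<in>{1..k}. X i \<noteq> 0")
    case True
    then show ?thesis using assms by (meson less_imp_le pos_def_def)
  next
    case False
    then show ?thesis by (auto simp: quad_form_def intro!: sum_nonneg)
  qed
  have L: "L \<le> g x" for x
  proof -
    have "- quad_form k a c (\<lambda>i. 1) / 8 \<le> tri_sum k a c 0 x"
      using tri_sum_eq_quad_form [of k a c x] nonneg [of "\<lambda>i. of_int (2 * x i + 1)"]
      by linarith
    then show ?thesis unfolding L_def g_def by (rule floor_mono)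
  qed
  obtain x0 where x0: "\<And>x. nat (g x0 - L) \<le> nat (g x - L)"
    using ex_has_least_nat [of "\<lambda>_. True" undefined "\<lambda>x. nat (g x - L)"] by blast
  have min: "g x0 \<le> g x" for x
    using x0 [of x] L [of x] L [of x0] by linarith
  have iff: "normalized_totally_positive (tri_sum k a c C) \<longleftrightarrow>
      (\<forall>x. 0 \<le> g x + C) \<and> (\<exists>x. g x + C = 0)" for C
  proof -
    have "(of_int m :: real) \<in> \<nat> \<longleftrightarrow> 0 \<le> m" for m
      by (metis Nats_cases of_nat_in_Nats of_int_0_le_iff of_int_of_nat_eq of_nat_0_le_iff
          zero_le_imp_eq_int)
    moreover have "(0 :: real) = of_int m \<longleftrightarrow> m = 0" for m
      by auto
    ultimately show ?thesis
      unfolding normalized_totally_positive_def image_subset_iff image_iff g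
      by (simp del: of_int_add)
  qed
  show ?thesis
  proof (rule ex1I [of _ "- g x0"])
    show "normalized_totally_positive (tri_sum k a c (- g x0))"
      unfolding iff using min by auto
  next
    fix C assume "normalized_totally_positive (tri_sum k a c C)"
    then obtain x where "g x + C = 0" "0 \<le> g x0 + C" unfolding iff by blast
    then show "C = - g x0" using min [of x] by linarith
  qed
qed

end

theory Submission
  imports Defs "HOL-Computational_Algebra.Primes"
begin

text \<open>
  Fix \<open>m \<in> Z - Y\<close>. It suffices to find a triangular sum that represents every nonnegative integer
  except \<open>m\<close>. Take
  \<open>f = 3m T(z) + (m+1) (T(a) + T(b) + T(c) + T(d)) + \<Sum>\<^sub>i ((m+3) T(x\<^sub>i) - 4 B(z, x\<^sub>i))\<close> with \<open>m - 1\<close> variables \<open>x\<^sub>i\<close>.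
  Since \<open>4 B(x, y) \<le> 2 T(x) + 2 T(y)\<close>, the value of \<open>f\<close> is at least \<open>m + 1\<close> unless all variables lie in
  \<open>{0, -1}\<close>; then every \<open>- 4 B(z, x\<^sub>i)\<close> is \<open>0\<close> or \<open>1\<close> and \<open>f \<le> m - 1\<close>. Hence \<open>f\<close> misses \<open>m\<close>.
  Conversely, four triangular numbers represent all multiples of \<open>m + 1\<close>, the \<open>x\<^sub>i\<close> at \<open>z = 0\<close>
  provide the remainders \<open>0, \<dots>, m - 1\<close>, and \<open>z = 1\<close>, \<open>x\<^sub>i = 0\<close> gives \<open>2m + 1\<close>, which covers the
  residue class of \<open>m\<close> from there on. That four triangular numbers suffice is deduced from
  Lagrange's four-square theorem.
\<close>

section \<open>Lagrange's four-square theorem\<close>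

definition sum_of_four_squares :: "int \<Rightarrow> bool" where
  "sum_of_four_squares n \<longleftrightarrow> (\<exists>a b c d. n = a\<^sup>2 + b\<^sup>2 + c\<^sup>2 + d\<^sup>2)"

text \<open>Euler's identity: the multiplicativity of the quaternion norm.\<close>

lemma sum_of_four_squares_mult:
  assumes "sum_of_four_squares m" "sum_of_four_squares n"
  shows "sum_of_four_squares (m * n)"
proof -
  obtain a b c d where m: "m = a\<^sup>2 + b\<^sup>2 + c\<^sup>2 + d\<^sup>2"
    using assms(1) unfolding sum_of_four_squares_def by blast
  obtain e f g h where n: "n = e\<^sup>2 + f\<^sup>2 + g\<^sup>2 + h\<^sup>2"
    using assms(2) unfolding sum_of_four_squares_def by blast
  have "m * n = (a * e + b * f + c * g + d * h)\<^sup>2 + (a * f - b * e - c * h + d * g)\<^sup>2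
      + (a * g + b * h - c * e - d * f)\<^sup>2 + (a * h - b * g + c * f - d * e)\<^sup>2"
    unfolding m n by algebra
  then show ?thesis unfolding sum_of_four_squares_def by blast
qed

lemma balanced_residue:
  fixes a m :: int
  assumes "0 < m"
  obtains y k where "a = y + m * k" "\<bar>2 * y\<bar> \<le> m"
proof (cases "2 * (a mod m) \<le> m")
  case True
  moreover have "a = a mod m + m * (a div m)" by simp
  ultimately show ?thesis using that [of "a mod m" "a div m"] assms by simp
next
  case False
  moreover have "a = (a mod m - m) + m * (a div m + 1)" by (simp add: algebra_simps)
  moreover have "a mod m < m" using assms by simp
  ultimately show ?thesis using that [of "a mod m - m" "a div m + 1"] by simp
qed

text \<open>Replace the four roots by their least absolute residues \<open>e\<close>,
  \<open>f\<close>, \<open>g\<close>, \<open>h\<close> modulo \<open>m\<close>, whose squares sum to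
  \<open>m * r\<close> with \<open>r \<le> m\<close>. In Euler's identity for
  \<open>(m * p) * (m * r)\<close> all four roots are multiples of \<open>m\<close>; dividing them
  by \<open>m\<close> writes \<open>r * p\<close> as four squares.\<close>

lemma prime_multiple_descent:
  fixes p m :: int
  assumes p: "prime p" and m: "1 < m" "m < p" and sum: "sum_of_four_squares (m * p)"
  shows "\<exists>r. 1 \<le> r \<and> r < m \<and> sum_of_four_squares (r * p)"
proof -
  have ndvd: "\<not> m dvd p"
  proof
    assume "m dvd p"
    then have "m = 1 \<or> m = p" using p m unfolding prime_int_iff by (meson less_imp_le less_trans zero_less_one)
    then show False using m by simp
  qed
  have m_pos: "0 < m" using m by simp
  obtain a b c d where mp: "m * p = a\<^sup>2 + b\<^sup>2 + c\<^sup>2 + d\<^sup>2"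
    using sum unfolding sum_of_four_squares_def by blast
  obtain e i where e: "a = e + m * i" "\<bar>2 * e\<bar> \<le> m"
    by (rule balanced_residue [OF m_pos, of a])
  obtain f j where f: "b = f + m * j" "\<bar>2 * f\<bar> \<le> m"
    by (rule balanced_residue [OF m_pos, of b])
  obtain g k where g: "c = g + m * k" "\<bar>2 * g\<bar> \<le> m"
    by (rule balanced_residue [OF m_pos, of c])
  obtain h l where h: "d = h + m * l" "\<bar>2 * h\<bar> \<le> m"
    by (rule balanced_residue [OF m_pos, of d])
  \<comment> \<open>The squares of \<open>a - m * i\<close>, \<open>b - m * j\<close>,
    \<open>c - m * k\<close>, \<open>d - m * l\<close> add up to \<open>m\<close> times this
    number.\<close>
  define r where
    "r = p - 2 * (a * i + b * j + c * k + d * l) + m * (i\<^sup>2 + j\<^sup>2 + k\<^sup>2 + l\<^sup>2)"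
  have mr: "m * r = e\<^sup>2 + f\<^sup>2 + g\<^sup>2 + h\<^sup>2"
  proof -
    have "m * r = m * p - 2 * m * (a * i + b * j + c * k + d * l)
        + m\<^sup>2 * (i\<^sup>2 + j\<^sup>2 + k\<^sup>2 + l\<^sup>2)"
      unfolding r_def by (simp add: algebra_simps power2_eq_square)
    then show ?thesis unfolding mp e f g h by algebra
  qed
  \<comment> \<open>This form yields \<open>m dvd p\<close> in both cases to be excluded,
    \<open>r = 0\<close> and \<open>r = m\<close>.\<close>
  have p_eq: "p = r + (2 * e) * i + (2 * f) * j + (2 * g) * k + (2 * h) * l
      + m * (i\<^sup>2 + j\<^sup>2 + k\<^sup>2 + l\<^sup>2)"
    unfolding r_def e f g h by (simp add: algebra_simps power2_eq_square)
  have "m * (r * p) = m * ((p - (a * i + b * j + c * k + d * l))\<^sup>2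
      + (a * j - b * i - c * l + d * k)\<^sup>2
      + (a * k + b * l - c * i - d * j)\<^sup>2 + (a * l - b * k + c * j - d * i)\<^sup>2)"
    unfolding r_def using mp by algebra
  then have sum_rp: "sum_of_four_squares (r * p)"
    unfolding sum_of_four_squares_def using m by (metis less_irrefl mult_left_cancel not_one_less_zero)
  have le: "(2 * e)\<^sup>2 \<le> m\<^sup>2" "(2 * f)\<^sup>2 \<le> m\<^sup>2" "(2 * g)\<^sup>2 \<le> m\<^sup>2" "(2 * h)\<^sup>2 \<le> m\<^sup>2"
    unfolding abs_le_square_iff [symmetric] using e(2) f(2) g(2) h(2) by linarith+
  have mr4: "4 * (m * r) = (2 * e)\<^sup>2 + (2 * f)\<^sup>2 + (2 * g)\<^sup>2 + (2 * h)\<^sup>2"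
    unfolding mr by (simp add: power2_eq_square)
  have "m * r \<le> m * m"
    using mr4 le by (simp add: power2_eq_square)
  then have "r \<le> m" using m by simp
  have "0 \<le> m * r" unfolding mr by simp
  then have "0 \<le> r" using m by (simp add: zero_le_mult_iff)
  have "r \<noteq> 0"
  proof
    assume "r = 0"
    then have "e\<^sup>2 + f\<^sup>2 + g\<^sup>2 + h\<^sup>2 = 0" using mr by simp
    then have "e = 0 \<and> f = 0 \<and> g = 0 \<and> h = 0"
      by (smt (verit) zero_le_power2 power2_eq_iff_nonneg power_zero_numeral zero_eq_power2)
    then have "p = m * (i\<^sup>2 + j\<^sup>2 + k\<^sup>2 + l\<^sup>2)" using p_eq \<open>r = 0\<close> by simp
    then show False using ndvd by simp
  qed
  moreover have "r \<noteq> m"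
  proof
    assume "r = m"
    then have "4 * m\<^sup>2 = (2 * e)\<^sup>2 + (2 * f)\<^sup>2 + (2 * g)\<^sup>2 + (2 * h)\<^sup>2"
      using mr4 by (simp only: power2_eq_square)
    \<comment> \<open>Equality in the sum forces equality in all four bounds of \<open>le\<close>,
      so each doubled residue is \<open>m\<close> or \<open>- m\<close>.\<close>
    then have "(2 * e)\<^sup>2 = m\<^sup>2" "(2 * f)\<^sup>2 = m\<^sup>2" "(2 * g)\<^sup>2 = m\<^sup>2" "(2 * h)\<^sup>2 = m\<^sup>2"
      using le by linarith+
    then have "m dvd 2 * e" "m dvd 2 * f" "m dvd 2 * g" "m dvd 2 * h"
      unfolding power2_eq_iff by auto
    then have "m dvd p"
      unfolding p_eq \<open>r = m\<close> by (intro dvd_add) (simp_all only: dvd_mult2 dvd_refl dvd_triv_left)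
    then show False using ndvd by simp
  qed
  ultimately show ?thesis
    using sum_rp \<open>0 \<le> r\<close> \<open>r \<le> m\<close> by (intro exI [of _ r]) auto
qed

lemma sum_of_four_squares_prime_multiple:
  fixes p m :: int
  assumes "prime p" "1 \<le> m" "m < p" "sum_of_four_squares (m * p)"
  shows "sum_of_four_squares p"
  using assms(2-4)
proof (induction "nat m" arbitrary: m rule: less_induct)
  case less
  show ?case
  proof (cases "m = 1")
    case True
    then show ?thesis using less.prems by simp
  next
    case False
    then obtain r where "1 \<le> r" "r < m" "sum_of_four_squares (r * p)"
      using prime_multiple_descent [OF assms(1)] less.prems by force
    then show ?thesis using less.hyps [of r] less.prems by simp
  qed
qed

text \<open>A prime dividing \<open>(x - y) * (x + y)\<close> divides a factor, and on
  \<open>{0..h}\<close> both factors are smaller than \<open>p\<close> in absolute value.\<close>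

lemma inj_on_square_mod_prime:
  fixes p h :: int
  assumes "prime p" "2 * h < p"
  shows "inj_on (\<lambda>x. x\<^sup>2 mod p) {0..h}"
proof (rule inj_onI)
  fix x y assume x: "x \<in> {0..h}" and y: "y \<in> {0..h}" and "x\<^sup>2 mod p = y\<^sup>2 mod p"
  then have "p dvd x\<^sup>2 - y\<^sup>2" by (simp add: mod_eq_dvd_iff)
  also have "x\<^sup>2 - y\<^sup>2 = (x - y) * (x + y)" by (simp add: algebra_simps power2_eq_square)
  finally consider "p dvd x - y" | "p dvd x + y"
    using assms(1) prime_dvd_mult_iff by blast
  then show "x = y"
  proof cases
    case 1
    moreover have "\<bar>x - y\<bar> < p" using x y assms(2) by auto
    ultimately have "x - y = 0" using dvd_imp_le_int [of "x - y" p] by linarith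
    then show ?thesis by simp
  next
    case 2
    then have "x + y = 0"
      using dvd_imp_le_int [of "x + y" p] x y assms(2) by auto
    then show ?thesis using x y by simp
  qed
qed

text \<open>Pigeonhole: with \<open>p = 2 * h + 1\<close>, the residues of \<open>x\<^sup>2\<close>
  and those of \<open>- 1 - y\<^sup>2\<close> for arguments in \<open>{0..h}\<close> form two sets
  of size \<open>h + 1\<close>. Together that is \<open>p + 1\<close>, so they meet.\<close>

lemma odd_prime_dvd_sum_two_squares_plus_one:
  fixes p :: int
  assumes p: "prime p" "odd p"
  obtains x y where "0 \<le> x" "0 \<le> y" "2 * x < p" "2 * y < p" "p dvd x\<^sup>2 + y\<^sup>2 + 1"
proof -
  obtain h where h: "p = 2 * h + 1" using p(2) by (elim oddE)
  have "0 < p" using p(1) by (simp add: prime_gt_0_int)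
  then have "0 \<le> h" using h by simp
  let ?A = "(\<lambda>x. x\<^sup>2 mod p) ` {0..h}" and ?B = "(\<lambda>y. (- 1 - y\<^sup>2) mod p) ` {0..h}"
  have inj: "inj_on (\<lambda>x. x\<^sup>2 mod p) {0..h}"
    using inj_on_square_mod_prime p(1) h by simp
  moreover have "inj_on (\<lambda>y. (- 1 - y\<^sup>2) mod p) {0..h}"
  proof (rule inj_onI)
    fix x y assume xy: "x \<in> {0..h}" "y \<in> {0..h}" "(- 1 - x\<^sup>2) mod p = (- 1 - y\<^sup>2) mod p"
    then have "p dvd (- 1 - x\<^sup>2) - (- 1 - y\<^sup>2)" by (simp only: mod_eq_dvd_iff)
    then have "p dvd y\<^sup>2 - x\<^sup>2" by simp
    then have "y\<^sup>2 mod p = x\<^sup>2 mod p" by (simp only: mod_eq_dvd_iff)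
    then show "x = y" using inj xy by (auto dest: inj_onD)
  qed
  ultimately have card: "card ?A = nat (h + 1)" "card ?B = nat (h + 1)"
    by (simp_all add: card_image)
  have "?A \<inter> ?B \<noteq> {}"
  proof
    assume "?A \<inter> ?B = {}"
    then have "card (?A \<union> ?B) = nat (h + 1) + nat (h + 1)"
      by (simp add: card_Un_disjoint card)
    moreover have "card (?A \<union> ?B) \<le> card {0..<p}"
      using \<open>0 < p\<close> by (intro card_mono) auto
    ultimately show False using h \<open>0 \<le> h\<close> by simp
  qed
  then obtain w where "w \<in> ?A" "w \<in> ?B" by blast
  then obtain x y where xy: "x \<in> {0..h}" "y \<in> {0..h}" "x\<^sup>2 mod p = (- 1 - y\<^sup>2) mod p"
    by (metis (no_types, lifting) imageE)
  then have "p dvd x\<^sup>2 - (- 1 - y\<^sup>2)" by (simp only: mod_eq_dvd_iff)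
  then have "p dvd x\<^sup>2 + y\<^sup>2 + 1" by (simp add: algebra_simps)
  then show ?thesis using that xy h by auto
qed

text \<open>For odd \<open>p\<close> the descent starts from
  \<open>x\<^sup>2 + y\<^sup>2 + 1\<^sup>2 + 0\<^sup>2 = m * p\<close>; the bounds
  \<open>2 * x < p\<close> and \<open>2 * y < p\<close> make \<open>m < p\<close>.\<close>

lemma sum_of_four_squares_prime:
  fixes p :: int
  assumes "prime p"
  shows "sum_of_four_squares p"
proof (cases "even p")
  case True
  then have "2 = p"
    using assms by (intro primes_dvd_imp_eq) auto
  moreover have "2 = (1::int)\<^sup>2 + 1\<^sup>2 + 0\<^sup>2 + 0\<^sup>2" by simp
  ultimately show ?thesis unfolding sum_of_four_squares_def by blast
next
  case False
  then obtain x y where xy: "0 \<le> x" "0 \<le> y" "2 * x < p" "2 * y < p" "p dvd x\<^sup>2 + y\<^sup>2 + 1"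
    using odd_prime_dvd_sum_two_squares_plus_one assms by blast
  then obtain m where m: "x\<^sup>2 + y\<^sup>2 + 1 = m * p" by (metis dvdE mult.commute)
  have p: "1 < p" using assms prime_gt_1_int by simp
  have "0 < m * p" unfolding m [symmetric] by (simp add: add_nonneg_pos)
  then have "1 \<le> m" using p by (simp add: zero_less_mult_iff)
  have "(2 * x)\<^sup>2 \<le> (p - 1)\<^sup>2" "(2 * y)\<^sup>2 \<le> (p - 1)\<^sup>2"
    using xy by (intro power_mono; simp)+
  then have "4 * (m * p) \<le> 2 * (p - 1)\<^sup>2 + 4"
    unfolding m [symmetric] by (simp add: power_mult_distrib)
  also have "\<dots> < 4 * (p * p)"
  proof -
    have "1 * 1 < p * p" using p by (intro mult_strict_mono) auto
    then show ?thesis using p by (simp add: power2_eq_square algebra_simps)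
  qed
  finally have "m < p" using p by simp
  moreover have "sum_of_four_squares (m * p)"
    unfolding sum_of_four_squares_def m [symmetric]
    by (intro exI [of _ x] exI [of _ y] exI [of _ 1] exI [of _ 0]) simp
  ultimately show ?thesis
    using sum_of_four_squares_prime_multiple assms \<open>1 \<le> m\<close> by blast
qed

theorem lagrange_four_squares: "sum_of_four_squares (int n)"
proof (induction n rule: prime_divisors_induct)
  case zero
  then show ?case unfolding sum_of_four_squares_def by (intro exI [of _ 0]) simp
next
  case (unit n)
  then show ?case unfolding sum_of_four_squares_def
    by (intro exI [of _ 1] exI [of _ 0]) simp
next
  case (factor p n)
  then show ?case
    using sum_of_four_squares_mult [OF sum_of_four_squares_prime, of "int p" "int n"] by simp
qed

section \<open>Triangular numbers\<close>

text \<open>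
  Writing \<open>2n + 1 = a\<^sup>2 + b\<^sup>2 + c\<^sup>2 + d\<^sup>2\<close>, the four numbers \<open>a \<plusminus> b \<plusminus> c \<plusminus> d\<close> with an even number of
  minus signs are odd and their squares add up to \<open>4(2n + 1) = 8n + 4\<close>.
\<close>

lemma sum_of_four_triangular:
  obtains x y z w where "T x + T y + T z + T w = real n"
proof -
  obtain a b c d where abcd: "int (2 * n + 1) = a\<^sup>2 + b\<^sup>2 + c\<^sup>2 + d\<^sup>2"
    using lagrange_four_squares unfolding sum_of_four_squares_def by blast
  have "odd (a\<^sup>2 + b\<^sup>2 + c\<^sup>2 + d\<^sup>2)" unfolding abcd [symmetric] by simp
  then have "odd (a + b + c + d)" by simp
  then obtain x where x: "a + b + c + d = 2 * x + 1" by (elim oddE)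
  have T8: "8 * T y = of_int ((2 * y + 1)\<^sup>2 - 1)" for y
    unfolding T_def by (simp add: power2_eq_square algebra_simps)
  have odds: "2 * (x - c - d) + 1 = a + b - c - d" "2 * (x - b - d) + 1 = a - b + c - d"
      "2 * (x - b - c) + 1 = a - b - c + d" "2 * x + 1 = a + b + c + d"
    using x by simp_all
  have "8 * (T x + T (x - c - d) + T (x - b - d) + T (x - b - c))
      = of_int ((a + b + c + d)\<^sup>2 + (a + b - c - d)\<^sup>2 + (a - b + c - d)\<^sup>2 + (a - b - c + d)\<^sup>2 - 4)"
    unfolding distrib_left T8 odds by simp
  also have "(a + b + c + d)\<^sup>2 + (a + b - c - d)\<^sup>2 + (a - b + c - d)\<^sup>2 + (a - b - c + d)\<^sup>2 - 4
      = 4 * (a\<^sup>2 + b\<^sup>2 + c\<^sup>2 + d\<^sup>2) - 4"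
    by algebra
  also have "\<dots> = 8 * int n" unfolding abcd [symmetric] by simp
  finally show ?thesis using that [of x "x - c - d" "x - b - d" "x - b - c"] by simp
qed

lemma T_nonneg: "0 \<le> T x"
proof -
  have "0 \<le> x * (x + 1)" by (cases "0 \<le> x") (auto simp: zero_le_mult_iff)
  then have "(0::real) \<le> of_int (x * (x + 1))" by (simp only: of_int_0_le_iff)
  then show ?thesis unfolding T_def by simp
qed

lemma T_ge_1:
  assumes "x \<noteq> 0" "x \<noteq> - 1"
  shows "1 \<le> T x"
proof -
  have "2 \<le> x * (x + 1)"
  proof (cases "0 < x")
    case True
    then have "1 * 2 \<le> x * (x + 1)" by (intro mult_mono) auto
    then show ?thesis by simp
  next
    case False
    then have "2 * 1 \<le> (- x) * (- (x + 1))" using assms by (intro mult_mono) auto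
    then show ?thesis by (simp add: algebra_simps)
  qed
  then have "(of_int 2 :: real) \<le> of_int (x * (x + 1))" by (simp only: of_int_le_iff)
  then show ?thesis unfolding T_def by simp
qed

text \<open>The right side minus the left is \<open>(x - y)\<^sup>2\<close>.\<close>

lemma four_B_le: "4 * B x y \<le> 2 * T x + 2 * T y"
proof -
  have "0 \<le> (x - y)\<^sup>2" by simp
  then have "2 * x * y + x + y \<le> x * (x + 1) + y * (y + 1)"
    by (simp add: power2_eq_square algebra_simps)
  then have "(of_int (2 * x * y + x + y) :: real) \<le> of_int (x * (x + 1) + y * (y + 1))"
    by (simp only: of_int_le_iff)
  then show ?thesis unfolding T_def B_def by simp
qed

section \<open>A triangular sum missing exactly one positive integer\<close>

context
  fixes m k :: nat
  assumes m: "1 \<le> m" and k: "k = m + 4"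
begin

text \<open>Index \<open>1\<close> carries \<open>z\<close>, the indices \<open>2..5\<close> carry \<open>a, b, c, d\<close> and \<open>6..k\<close> carry the \<open>x\<^sub>i\<close>.\<close>

definition diag :: "nat \<Rightarrow> int" where
  "diag i = (if i = 1 then 3 * int m else if i \<le> 5 then int m + 1 else int m + 3)"

definition cross :: "nat \<Rightarrow> nat \<Rightarrow> int" where
  "cross i j = (if i = 1 \<and> 6 \<le> j then - 1 else 0)"

text \<open>The blocks have 1, 4 and \<open>m - 1\<close> indices; the last is empty for
  \<open>m = 1\<close>.\<close>

lemma sum_split:
  fixes F :: "nat \<Rightarrow> real"
  shows "(\<Sum>i = 1..k. F i) = F 1 + (\<Sum>i = 2..5. F i) + (\<Sum>i = 6..k. F i)"
proof -
  have "{1..k} = insert 1 ({2..5} \<union> {6..k})" using m k by auto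
  then show ?thesis by (simp add: sum.union_disjoint)
qed

text \<open>Keeping \<open>F\<close> arbitrary, like \<open>G\<close> in \<open>sum_cross\<close>,
  serves both the quadratic form and the triangular sum.\<close>

lemma sum_diag:
  "(\<Sum>i = 1..k. of_int (diag i) * F i) =
     3 * real m * F 1 + (real m + 1) * (\<Sum>i = 2..5. F i) + (real m + 3) * (\<Sum>i = 6..k. F i)"
  unfolding sum_split sum_distrib_left by (simp add: diag_def)

lemma sum_cross:
  "(\<Sum>i = 1..k. \<Sum>j = i + 1..k. 4 * of_int (cross i j) * G i j) = - (\<Sum>j = 6..k. 4 * G 1 j)"
  for G :: "nat \<Rightarrow> nat \<Rightarrow> real"
proof -
  have "(\<Sum>i = 1..k. \<Sum>j = i + 1..k. 4 * of_int (cross i j) * G i j) =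
      (\<Sum>j = 2..k. 4 * of_int (cross 1 j) * G 1 j)"
    unfolding sum_split by (simp add: cross_def numeral_2_eq_2)
  also have "\<dots> = (\<Sum>j = 6..k. - (4 * G 1 j))"
    by (rule sum.mono_neutral_cong_right) (auto simp: cross_def)
  finally show ?thesis by (simp add: sum_negf)
qed

text \<open>Each of the \<open>m - 1\<close> cross terms costs at most 2 squares of
  \<open>X 1\<close> and 2 of \<open>X i\<close>. This leaves coefficients
  \<open>3m - 2(m - 1) = m + 2\<close> at index 1 and \<open>m + 1\<close> at all others.\<close>

lemma pos_def_diag_cross: "pos_def k diag cross"
  unfolding pos_def_def
proof (intro allI impI)
  fix X :: "nat \<Rightarrow> real" assume "\<exists>i\<in>{1..k}. X i \<noteq> 0"
  then have "0 < (\<Sum>i = 1..k. (X i)\<^sup>2)"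
    by (metis finite_atLeastAtMost sum_pos2 zero_le_power2 zero_less_power2)
  then have "0 < (X 1)\<^sup>2 + (\<Sum>i = 2..5. (X i)\<^sup>2) + (\<Sum>i = 6..k. (X i)\<^sup>2)"
    unfolding sum_split .
  also have "\<dots> \<le> (real m + 2) * (X 1)\<^sup>2 + (real m + 1) * (\<Sum>i = 2..5. (X i)\<^sup>2)
      + (real m + 1) * (\<Sum>i = 6..k. (X i)\<^sup>2)"
    using sum_nonneg [of "{2..5}" "\<lambda>i. (X i)\<^sup>2"] sum_nonneg [of "{6..k}" "\<lambda>i. (X i)\<^sup>2"]
    by (intro add_mono) (simp_all add: mult_le_cancel_right1)
  also have "\<dots> \<le> 3 * real m * (X 1)\<^sup>2 + (real m + 1) * (\<Sum>i = 2..5. (X i)\<^sup>2)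
      + (real m + 3) * (\<Sum>i = 6..k. (X i)\<^sup>2) - (\<Sum>i = 6..k. 4 * (X 1 * X i))"
  proof -
    have "4 * (X 1 * X i) \<le> 2 * (X 1)\<^sup>2 + 2 * (X i)\<^sup>2" for i
      using zero_le_power2 [of "X 1 - X i"] by (simp add: power2_eq_square algebra_simps)
    then have "(\<Sum>i = 6..k. 4 * (X 1 * X i)) \<le> (\<Sum>i = 6..k. 2 * (X 1)\<^sup>2 + 2 * (X i)\<^sup>2)"
      by (intro sum_mono)
    also have "\<dots> = 2 * (real m - 1) * (X 1)\<^sup>2 + 2 * (\<Sum>i = 6..k. (X i)\<^sup>2)"
      using m k by (simp add: sum.distrib sum_distrib_left of_nat_diff)
    finally show ?thesis by (simp add: algebra_simps)
  qed
  also have "\<dots> = quad_form k diag cross X"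
    unfolding quad_form_def sum_diag mult.assoc [of _ "X _"] sum_cross by simp
  finally show "0 < quad_form k diag cross X" .
qed

lemma tri_sum_diag_cross:
  "tri_sum k diag cross 0 x = 3 * real m * T (x 1) + (real m + 1) * (\<Sum>i = 2..5. T (x i))
     + (real m + 3) * (\<Sum>i = 6..k. T (x i)) - (\<Sum>i = 6..k. 4 * B (x 1) (x i))"
  unfolding tri_sum_def sum_diag sum_cross by simp

text \<open>The same count as for positive definiteness, with \<open>four_B_le\<close> bounding the
  cross terms.\<close>

lemma tri_sum_diag_cross_ge: "(real m + 1) * (\<Sum>i = 1..k. T (x i)) \<le> tri_sum k diag cross 0 x"
proof -
  have "(\<Sum>i = 6..k. 4 * B (x 1) (x i)) \<le> (\<Sum>i = 6..k. 2 * T (x 1) + 2 * T (x i))"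
    by (intro sum_mono four_B_le)
  also have "\<dots> = 2 * (real m - 1) * T (x 1) + 2 * (\<Sum>i = 6..k. T (x i))"
    using m k by (simp add: sum.distrib sum_distrib_left of_nat_diff)
  finally show ?thesis
    unfolding tri_sum_diag_cross sum_split using T_nonneg [of "x 1"] by (simp add: algebra_simps)
qed

lemma tri_sum_diag_cross_neq: "tri_sum k diag cross 0 x \<noteq> real m"
proof (cases "\<exists>i\<in>{1..k}. x i \<noteq> 0 \<and> x i \<noteq> - 1")
  case True
  then obtain i where "i \<in> {1..k}" "1 \<le> T (x i)" using T_ge_1 by blast
  then have "1 \<le> (\<Sum>i = 1..k. T (x i))"
    using member_le_sum [of i "{1..k}" "\<lambda>i. T (x i)"] T_nonneg by fastforce
  then have "(real m + 1) * 1 \<le> (real m + 1) * (\<Sum>i = 1..k. T (x i))"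
    by (intro mult_left_mono) auto
  then have "(real m + 1) * 1 \<le> tri_sum k diag cross 0 x"
    using tri_sum_diag_cross_ge [of x] by (rule order_trans)
  then show ?thesis by simp
next
  case False
  then have x: "x i = 0 \<or> x i = - 1" if "i \<in> {1..k}" for i using that by blast
  have "T (x i) = 0" if "i \<in> {1..k}" for i using x [OF that] by (auto simp: T_def)
  then have "tri_sum k diag cross 0 x = (\<Sum>i = 6..k. - (4 * B (x 1) (x i)))"
    unfolding tri_sum_diag_cross using m k by (simp add: sum_negf)
  \<comment> \<open>For arguments in \<open>{0, - 1}\<close>, \<open>- 4 * B\<close> is 1 if they
    differ and 0 if they agree.\<close>
  also have "\<dots> \<le> (\<Sum>i = 6..k. 1)"
  proof (rule sum_mono)
    fix i assume "i \<in> {6..k}"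
    then show "- (4 * B (x 1) (x i)) \<le> 1"
      using x [of 1] x [of i] m k by (auto simp: B_def)
  qed
  also have "\<dots> < real m" using m k by simp
  finally show ?thesis by simp
qed

lemma normalized_tri_sum_diag_cross: "normalized_totally_positive (tri_sum k diag cross 0)"
  unfolding normalized_totally_positive_def
proof
  show "range (tri_sum k diag cross 0) \<subseteq> \<nat>"
  proof clarify
    fix x
    have "0 \<le> (real m + 1) * (\<Sum>i = 1..k. T (x i))" by (simp add: sum_nonneg T_nonneg)
    then have "0 \<le> tri_sum k diag cross 0 x" using tri_sum_diag_cross_ge [of x] by linarith
    then show "tri_sum k diag cross 0 x \<in> \<nat>" using tri_sum_Ints by (simp add: Nats_altdef2)
  qed
  have "tri_sum k diag cross 0 (\<lambda>_. 0) = 0" by (simp add: tri_sum_def T_def B_def)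
  then show "0 \<in> range (tri_sum k diag cross 0)" by (metis rangeI)
qed

lemma represents_tri_sum_diag_cross:
  assumes "n \<noteq> m"
  shows "represents (tri_sum k diag cross 0) (int n)"
proof -
  define q r where "q = n div (m + 1)" and "r = n mod (m + 1)"
  have n: "n = q * (m + 1) + r" unfolding q_def r_def by (rule div_mult_mod_eq [symmetric])
  have "r \<le> m" unfolding r_def by (simp add: less_Suc_eq_le [symmetric])
  \<comment> \<open>The block \<open>2..5\<close> is free of cross terms, so it can supply any
    multiple of \<open>m + 1\<close> whatever the other variables are.\<close>
  have four: "\<exists>x. x 1 = z \<and> (\<forall>i\<ge>6. x i = y i) \<and> (\<Sum>i = 2..5. T (x i)) = real t"
    for z t and y :: "nat \<Rightarrow> int"
  proof -
    obtain a b c d where "T a + T b + T c + T d = real t" by (rule sum_of_four_triangular)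
    then show ?thesis
      by (intro exI [of _ "y(1 := z, 2 := a, 3 := b, 4 := c, 5 := d)"])
        (simp add: numeral_eq_Suc)
  qed
  show ?thesis
  proof (cases "r = m")
    case True
    then have "1 \<le> q" using assms n by (cases q) auto
    \<comment> \<open>These choices contribute \<open>3m - (m - 1) = (m + 1) + m\<close>, so one of
      the \<open>q\<close> multiples of \<open>m + 1\<close> is already used.\<close>
    obtain x :: "nat \<Rightarrow> int" where x: "x 1 = 1" "\<forall>i\<ge>6. x i = 0"
        "(\<Sum>i = 2..5. T (x i)) = real (q - 1)"
      using four [of 1 "\<lambda>_. 0" "q - 1"] by blast
    have "tri_sum k diag cross 0 x = 3 * real m + (real m + 1) * real (q - 1) - (real m - 1)"
      unfolding tri_sum_diag_cross using x m k by (simp add: T_def B_def of_nat_diff)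
    also have "\<dots> = real n"
      unfolding n True using \<open>1 \<le> q\<close> by (simp add: of_nat_diff algebra_simps)
    finally show ?thesis unfolding represents_def by auto
  next
    case False
    \<comment> \<open>The first \<open>r\<close> of the last \<open>m - 1\<close> variables are set
      to \<open>- 1\<close>, which fits as \<open>r < m\<close>; each adds 1, since
      \<open>T (- 1) = 0\<close> and \<open>4 * B 0 (- 1) = - 1\<close>.\<close>
    obtain x :: "nat \<Rightarrow> int"
      where x: "x 1 = 0" "\<forall>i\<ge>6. x i = (if i \<le> r + 5 then - 1 else 0)"
        "(\<Sum>i = 2..5. T (x i)) = real q"
      using four [of 0 "\<lambda>i. if i \<le> r + 5 then - 1 else 0" q] by blast
    have "(\<Sum>i = 6..k. T (x i)) = 0" by (rule sum.neutral) (simp add: x T_def)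
    moreover have "(\<Sum>i = 6..k. 4 * B (x 1) (x i)) = (\<Sum>i = 6..r + 5. - 1)"
      using x k False \<open>r \<le> m\<close> by (intro sum.mono_neutral_cong_right) (auto simp: B_def)
    ultimately have "tri_sum k diag cross 0 x = (real m + 1) * real q + real r"
      unfolding tri_sum_diag_cross using x by (simp add: T_def)
    also have "\<dots> = real n" unfolding n by (simp add: algebra_simps)
    finally show ?thesis unfolding represents_def by auto
  qed
qed

end

theorem theorem1p5:
  fixes Z Y :: "int set"
  assumes "\<forall>n\<in>Z. 0 < n"
    and "Y \<subset> Z"
  shows "\<exists>k f. triangular_sum_with_cross_terms k f \<and>
           (\<forall>n\<in>Y. represents f n) \<and> \<not> (\<forall>n\<in>Z. represents f n)"
proof -
  obtain z where z: "z \<in> Z" "z \<notin> Y" using assms(2) by blast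
  define m where "m = nat z"
  have m: "1 \<le> m" "int m = z" using assms(1) z unfolding m_def by force+
  let ?f = "tri_sum (m + 4) (diag m) cross 0"
  have "triangular_sum_with_cross_terms (m + 4) ?f"
    unfolding triangular_sum_with_cross_terms_def
    using pos_def_diag_cross [OF m(1) refl] normalized_tri_sum_diag_cross [OF m(1) refl] by auto
  moreover have "represents ?f n" if "n \<in> Y" for n
  proof -
    have "0 \<le> n" using that assms by (meson less_imp_le psubsetD)
    moreover have "nat n \<noteq> m" using that z m \<open>0 \<le> n\<close> by auto
    ultimately show ?thesis
      using represents_tri_sum_diag_cross [OF m(1) refl, of "nat n"] by simp
  qed
  moreover have "\<not> represents ?f z"
    using tri_sum_diag_cross_neq [OF m(1) refl] unfolding represents_def m(2) [symmetric] by simp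
  ultimately show ?thesis using z(1) by blast
qed

end
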